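(* Suppose that the measurable function $f:\mathbb{R}\to\mathbb{R}_+$ is either bounded or Lipschitz continuous with Lipschitz constant $\|f\|_{Lip}$, and that $\int\sum_{i=1}^L|c_i|\,G(dc_1,\ldots,dc_L)<\infty$. Consider the function $V:\mathbb{R}^\kappa\to\mathbb{R}_+$ defined by $$V(x)=1+\sum_{i=1}^L\sum_{k=0}^{n_i}\frac{b(k+1)}{\alpha_i^k}|x^{(i,k)}|,$$ where $b:\{0,1,\ldots,n+1\}\to\mathbb{R}_+$ is a strictly increasing function. If $f$ is not bounded but only Lipschitz continuous, suppose moreover that $$\|f\|_{Lip}\left(\int\sum_{i=1}^L\frac{1}{\alpha^{n_i}}|c_i|\,G(dc_1,\ldots,dc_L)\right)<\alpha$$ and choose the function $b$ so that $$\frac{b(n+1)}{b(1)}\|f\|_{Lip}\left(\int\sum_{i=1}^L\frac{1}{\alpha^{n_i}}|c_i|\,G(dc_1,\ldots,dc_L)\right)<\alpha.$$ Then there exist positive constants $\lambda$, $\beta$ and $R$ such that the Foster–Lyapunov type drift condition $$\mathcal{L}V(x)\le-\lambda V(x)+\beta 1_K(x)\qquad (x\in\mathbb{R}^\kappa)$$ holds, where $K=\bar B_R(0)$ is the closed ball in $\mathbb{R}^\kappa$ of center $0$ and radius $R$.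
   Context: $\mathbb{N}$ denotes the non-negative integers. Fix $L\ge 1$, $\alpha_1,\ldots,\alpha_L>0$, $n_1,\ldots,n_L\in\mathbb{N}$, and put $\kappa=L+\sum_{i=1}^L n_i$, $n=\max_i n_i$, $\alpha=\min_i\alpha_i$. Elements of $\mathbb{R}^\kappa$ are written $x=(x^{(1)},\ldots,x^{(L)})$ with $x^{(i)}=(x^{(i,0)},\ldots,x^{(i,n_i)})$; $e_{(i,n_i)}\in\mathbb{R}^\kappa$ is the unit vector with entry $1$ in coordinate $(i,n_i)$. Let $F:\mathbb{R}^\kappa\to\mathbb{R}^\kappa$ be the vector field with $F^{(i,k)}(x)=-\alpha_i x^{(i,k)}+x^{(i,k+1)}$ for $0\le k<n_i$ and $F^{(i,n_i)}(x)=-\alpha_i x^{(i,n_i)}$. Let $G$ be a probability measure on $\mathbb{R}^L$. The generator is $$\mathcal{L}g(x)=\langle F(x),\nabla g(x)\rangle+f\Big(\sum_{i=1}^L x^{(i,0)}\Big)\int\Big(g\big(x+\sum_{i=1}^L c_i e_{(i,n_i)}\big)-g(x)\Big)G(dc_1,\ldots,dc_L).$$ For the function $V$, which is not differentiable where a coordinate vanishes, $\mathcal{L}V$ is defined by this same formula with the derivative of $u\mapsto|u|$ taken to be $\mathrm{sg}(u)$, the sign of $u$ (with $\mathrm{sg}(0)=0$). *)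

theory Defs
  imports "HOL-Probability.Probability"
begin

text \<open>
  The finite type \<open>'l\<close> indexes the blocks, so \<open>L = CARD('l)\<close>, and \<open>n i + 1\<close> is the length of block \<open>i\<close>.
  The space of dimension \<open>\<kappa> = L + (\<Sum>i. n i)\<close> is \<open>real ^ 'k\<close>, where \<open>e i k\<close> names the coordinate
  \<open>(i,k)\<close> with \<open>k \<le> n i\<close>: the component $x^{(i,k)}$ is \<open>x $ e i k\<close>, and the unit vector
  $e_{(i,k)}$ is \<open>axis (e i k) 1\<close>. The predicate below forces \<open>CARD('k) = \<kappa>\<close>; values
  of \<open>e i k\<close> with \<open>k > n i\<close> are never used.
\<close>

definition coordinate_labelling :: "('l::finite \<Rightarrow> nat) \<Rightarrow> ('l \<Rightarrow> nat \<Rightarrow> 'k::finite) \<Rightarrow> bool" where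
  "coordinate_labelling n e \<longleftrightarrow> bij_betw (\<lambda>(i, k). e i k) (SIGMA i:UNIV. {..n i}) UNIV"

definition drift_field ::
  "('l::finite \<Rightarrow> nat) \<Rightarrow> ('l \<Rightarrow> nat \<Rightarrow> 'k::finite) \<Rightarrow> ('l \<Rightarrow> real) \<Rightarrow> real ^ 'k \<Rightarrow> real ^ 'k" where
  "drift_field n e \<alpha> x =
     (\<Sum>i\<in>UNIV. \<Sum>k\<le>n i.
        (if k < n i then - \<alpha> i * x $ e i k + x $ e i (k + 1) else - \<alpha> i * x $ e i k)
          *\<^sub>R axis (e i k) 1)"

text \<open>
  The gradient of \<open>g\<close> is a separate argument \<open>dg\<close>, because the generator is also applied to a
  function that is not differentiable everywhere.
\<close>

definition generator ::
  "('l::finite \<Rightarrow> nat) \<Rightarrow> ('l \<Rightarrow> nat \<Rightarrow> 'k::finite) \<Rightarrow> ('l \<Rightarrow> real) \<Rightarrow> (real \<Rightarrow> real) \<Rightarrow> (real ^ 'l) measure \<Rightarrow>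
   (real ^ 'k \<Rightarrow> real) \<Rightarrow> (real ^ 'k \<Rightarrow> real ^ 'k) \<Rightarrow> real ^ 'k \<Rightarrow> real" where
  "generator n e \<alpha> f G g dg x =
     drift_field n e \<alpha> x \<bullet> dg x
     + f (\<Sum>i\<in>UNIV. x $ e i 0) *
       (\<integral>c. (g (x + (\<Sum>i\<in>UNIV. c $ i *\<^sub>R axis (e i (n i)) 1)) - g x) \<partial>G)"

definition lyapunov ::
  "('l::finite \<Rightarrow> nat) \<Rightarrow> ('l \<Rightarrow> nat \<Rightarrow> 'k::finite) \<Rightarrow> ('l \<Rightarrow> real) \<Rightarrow> (nat \<Rightarrow> real) \<Rightarrow> real ^ 'k \<Rightarrow> real" where
  "lyapunov n e \<alpha> b x = 1 + (\<Sum>i\<in>UNIV. \<Sum>k\<le>n i. b (k + 1) / \<alpha> i ^ k * \<bar>x $ e i k\<bar>)"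

text \<open>
  The gradient of \<^const>\<open>lyapunov\<close> under the convention that the derivative of \<open>\<lambda>u. \<bar>u\<bar>\<close>
  is \<^const>\<open>sgn\<close> (with value \<open>0\<close> at \<open>0\<close>).
\<close>

definition lyapunov_grad ::
  "('l::finite \<Rightarrow> nat) \<Rightarrow> ('l \<Rightarrow> nat \<Rightarrow> 'k::finite) \<Rightarrow> ('l \<Rightarrow> real) \<Rightarrow> (nat \<Rightarrow> real) \<Rightarrow> real ^ 'k \<Rightarrow> real ^ 'k" where
  "lyapunov_grad n e \<alpha> b x =
     (\<Sum>i\<in>UNIV. \<Sum>k\<le>n i. (b (k + 1) / \<alpha> i ^ k * sgn (x $ e i k)) *\<^sub>R axis (e i k) 1)"

end

theory Submission imports Defs begin

text \<open>
  Two effects compete in the generator applied to \<open>V\<close>. Along a block, the drift shrinks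
  coordinate \<open>k\<close> at rate \<open>\<alpha> i\<close>, while coordinate \<open>k\<close> feeds the growth of coordinate \<open>k - 1\<close>
  at rate \<open>1\<close>. The weights \<open>b (k + 1) / \<alpha> i ^ k\<close> are tuned to this chain: per unit of
  \<open>\<bar>x $ e i k\<bar>\<close>, what \<open>V\<close> loses at coordinate \<open>k\<close> exceeds what it gains at coordinate \<open>k - 1\<close> by
  \<open>\<alpha> i / \<alpha> i ^ k * (b (k + 1) - b k)\<close>, which is positive because \<open>b\<close> increases; coordinate \<open>0\<close>
  feeds nothing and loses \<open>\<alpha> i * b 1\<close>. So the drift is at most a strictly negative combination of
  the \<open>\<bar>x $ e i k\<bar>\<close> (\<open>drift_lyapunov_le\<close>).

  A jump changes only the top coordinate of each block, so the triangle inequality bounds the mean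
  increase of \<open>V\<close> by the constant \<open>J = b (N + 1) * M\<close>, where \<open>N\<close> is the largest \<open>n i\<close> and \<open>M\<close> is
  the weighted first moment of \<open>G\<close> (\<open>integral_jump_lyapunov_le\<close>). The intensity satisfies
  \<open>f u \<le> c\<^sub>0 + \<rho> * \<bar>u\<bar>\<close>, with \<open>\<rho> = 0\<close> if \<open>f\<close> is bounded and \<open>\<rho> = Lip\<close> otherwise. Since \<open>f\<close> sees
  only the coordinates \<open>(i, 0)\<close>, the jumps reduce the loss rate \<open>\<alpha> i * b 1\<close> of these coordinates
  by \<open>\<rho> * J\<close>, and the smallness condition on \<open>b\<close> ensures that a positive rate remains.

  Thus the generator is at most a constant minus a positive combination of the
  \<open>\<bar>x $ e i k\<bar>\<close>. There are finitely many coordinates, so such a combination dominates a positive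
  multiple of \<open>V - 1\<close>; half of that multiple is the rate \<open>lam\<close>, and the other half absorbs the constant
  outside a large ball, because \<open>V\<close> grows at least linearly in the norm
  (\<open>foster_lyapunov_of_coordinate_bound\<close>).
\<close>

section \<open>Coordinates\<close>

lemma coordinate_eq_iff:
  assumes "coordinate_labelling n e" "k \<le> n i" "l \<le> n j"
  shows "e i k = e j l \<longleftrightarrow> i = j \<and> k = l"
proof -
  have "inj_on (\<lambda>(i, k). e i k) (SIGMA i:UNIV. {..n i})"
    using assms(1) by (simp add: coordinate_labelling_def bij_betw_def)
  from inj_onD[OF this, of "(i, k)" "(j, l)"] show ?thesis
    using assms(2,3) by auto
qed

lemma sum_coordinates:
  fixes h :: "'k::finite \<Rightarrow> 'a::comm_monoid_add"
  assumes "coordinate_labelling n e"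
  shows "(\<Sum>s\<in>UNIV. h s) = (\<Sum>i\<in>UNIV. \<Sum>k\<le>n i. h (e i k))"
proof -
  have "(\<Sum>s\<in>UNIV. h s) = (\<Sum>p\<in>(SIGMA i:UNIV. {..n i}). h (case p of (i, k) \<Rightarrow> e i k))"
    using assms unfolding coordinate_labelling_def
    by (rule sum.reindex_bij_betw[symmetric])
  also have "\<dots> = (\<Sum>i\<in>UNIV. \<Sum>k\<le>n i. h (e i k))"
    by (subst sum.Sigma) (auto intro: sum.cong)
  finally show ?thesis .
qed

lemma component_sum_axis:
  fixes e :: "'l::finite \<Rightarrow> nat \<Rightarrow> 'k::finite" and a :: "'l \<Rightarrow> nat \<Rightarrow> real"
  assumes e: "coordinate_labelling n e" and l: "l \<le> n j"
  shows "(\<Sum>i\<in>UNIV. \<Sum>k\<le>n i. a i k *\<^sub>R axis (e i k) 1) $ e j l = a j l"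
proof -
  have "(\<Sum>i\<in>UNIV. \<Sum>k\<le>n i. a i k *\<^sub>R axis (e i k) 1) $ e j l
      = (\<Sum>i\<in>UNIV. \<Sum>k\<le>n i. if i = j \<and> k = l then a i k else 0)"
    by (auto simp: axis_def coordinate_eq_iff[OF e _ l] coordinate_eq_iff[OF e l]
        intro!: sum.cong)
  also have "\<dots> = (\<Sum>i\<in>UNIV. if i = j then a j l else 0)"
    using l by (intro sum.cong) auto
  finally show ?thesis by simp
qed

section \<open>The two parts of the generator\<close>

text \<open>
  The sign convention enters only through \<open>sgn y * y = \<bar>y\<bar>\<close> and \<open>sgn y * z \<le> \<bar>z\<bar>\<close>. The rest is a
  shift of the summation index: the term that coordinate \<open>k\<close> receives from coordinate \<open>k + 1\<close>
  is charged to the latter.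
\<close>

lemma block_drift_le:
  fixes y :: "nat \<Rightarrow> real" and a :: real
  assumes a: "a > 0" and b: "\<And>k. k \<le> m + 1 \<Longrightarrow> b k \<ge> 0"
  shows "(\<Sum>k\<le>m. (if k < m then - a * y k + y (k + 1) else - a * y k) * (b (k + 1) / a ^ k * sgn (y k)))
    \<le> - (\<Sum>k\<le>m. a / a ^ k * (b (k + 1) - (if k = 0 then 0 else b k)) * \<bar>y k\<bar>)"
proof -
  let ?w = "\<lambda>k. b (k + 1) / a ^ k"
  let ?in = "\<lambda>k. if k = 0 then 0 else ?w (k - 1) * \<bar>y k\<bar>"
  have term_le: "(if k < m then - a * y k + y (k + 1) else - a * y k) * (?w k * sgn (y k))
      \<le> - a * ?w k * \<bar>y k\<bar> + (if k < m then ?w k * \<bar>y (k + 1)\<bar> else 0)" if "k \<le> m" for k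
  proof -
    have w: "?w k \<ge> 0" using a b that by simp
    have "sgn (y k) * y (k + 1) \<le> \<bar>y (k + 1)\<bar>" by (auto simp: sgn_if)
    from mult_left_mono[OF this w]
    have 1: "y (k + 1) * (?w k * sgn (y k)) \<le> ?w k * \<bar>y (k + 1)\<bar>" by (simp add: mult_ac)
    have 2: "- a * y k * (?w k * sgn (y k)) = - a * ?w k * \<bar>y k\<bar>"
      by (simp add: abs_sgn mult_ac)
    show ?thesis
    proof (cases "k < m")
      case True
      then show ?thesis using 1 2 by (simp only: if_True distrib_right)
    next
      case False
      then show ?thesis using 2 by (simp only: if_False)
    qed
  qed
  have shift: "(\<Sum>k\<le>m. if k < m then ?w k * \<bar>y (k + 1)\<bar> else 0) = (\<Sum>k\<le>m. ?in k)"
  proof -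
    have "(\<Sum>k\<le>m. if k < m then ?w k * \<bar>y (k + 1)\<bar> else 0) = (\<Sum>k<m. ?w k * \<bar>y (k + 1)\<bar>)"
      by (simp add: lessThan_Suc_atMost[symmetric])
    also have "\<dots> = (\<Sum>k\<le>m. ?in k)"
      by (simp add: sum.atMost_shift)
    finally show ?thesis .
  qed
  have "(\<Sum>k\<le>m. (if k < m then - a * y k + y (k + 1) else - a * y k) * (?w k * sgn (y k)))
      \<le> (\<Sum>k\<le>m. - a * ?w k * \<bar>y k\<bar> + (if k < m then ?w k * \<bar>y (k + 1)\<bar> else 0))"
    using term_le by (intro sum_mono) auto
  also have "\<dots> = (\<Sum>k\<le>m. - a * ?w k * \<bar>y k\<bar> + ?in k)"
    by (simp only: sum.distrib shift)
  also have "\<dots> = (\<Sum>k\<le>m. - (a / a ^ k * (b (k + 1) - (if k = 0 then 0 else b k)) * \<bar>y k\<bar>))"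
  proof (rule sum.cong[OF refl])
    fix k
    show "- a * ?w k * \<bar>y k\<bar> + ?in k
      = - (a / a ^ k * (b (k + 1) - (if k = 0 then 0 else b k)) * \<bar>y k\<bar>)"
      using a by (cases k) (auto simp: field_simps)
  qed
  finally show ?thesis by (simp only: sum_negf)
qed

lemma drift_lyapunov_le:
  fixes e :: "'l::finite \<Rightarrow> nat \<Rightarrow> 'k::finite"
  assumes e: "coordinate_labelling n e" and a: "\<And>i. \<alpha> i > 0"
    and b: "\<And>i k. k \<le> n i + 1 \<Longrightarrow> b k \<ge> 0"
  shows "drift_field n e \<alpha> x \<bullet> lyapunov_grad n e \<alpha> b x
    \<le> - (\<Sum>i\<in>UNIV. \<Sum>k\<le>n i.
          \<alpha> i / \<alpha> i ^ k * (b (k + 1) - (if k = 0 then 0 else b k)) * \<bar>x $ e i k\<bar>)"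
proof -
  have "drift_field n e \<alpha> x \<bullet> lyapunov_grad n e \<alpha> b x
      = (\<Sum>i\<in>UNIV. \<Sum>k\<le>n i. drift_field n e \<alpha> x $ e i k * lyapunov_grad n e \<alpha> b x $ e i k)"
    unfolding inner_vec_def by (subst sum_coordinates[OF e]) simp
  also have "\<dots> = (\<Sum>i\<in>UNIV. \<Sum>k\<le>n i.
       (if k < n i then - \<alpha> i * x $ e i k + x $ e i (k + 1) else - \<alpha> i * x $ e i k)
         * (b (k + 1) / \<alpha> i ^ k * sgn (x $ e i k)))"
    by (intro sum.cong refl)
      (simp only: drift_field_def lyapunov_grad_def component_sum_axis[OF e] atMost_iff)
  also have "\<dots> \<le> (\<Sum>i\<in>UNIV. - (\<Sum>k\<le>n i.
       \<alpha> i / \<alpha> i ^ k * (b (k + 1) - (if k = 0 then 0 else b k)) * \<bar>x $ e i k\<bar>))"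
    by (intro sum_mono block_drift_le a b)
  finally show ?thesis by (simp only: sum_negf)
qed

lemma jump_lyapunov_le:
  fixes e :: "'l::finite \<Rightarrow> nat \<Rightarrow> 'k::finite"
  assumes e: "coordinate_labelling n e" and a: "\<And>i. \<alpha> i > 0"
    and b: "\<And>i k. k \<le> n i + 1 \<Longrightarrow> b k \<ge> 0"
  shows "lyapunov n e \<alpha> b (x + (\<Sum>i\<in>UNIV. c $ i *\<^sub>R axis (e i (n i)) 1)) - lyapunov n e \<alpha> b x
    \<le> (\<Sum>i\<in>UNIV. b (n i + 1) / \<alpha> i ^ n i * \<bar>c $ i\<bar>)"
proof -
  let ?s = "\<lambda>i k. if k = n i then c $ i else 0"
  have jump: "(\<Sum>i\<in>UNIV. c $ i *\<^sub>R axis (e i (n i)) 1)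
      = (\<Sum>i\<in>UNIV. \<Sum>k\<le>n i. ?s i k *\<^sub>R axis (e i k) (1::real))"
  proof (rule sum.cong[OF refl])
    fix i
    have "(\<Sum>k\<le>n i. ?s i k *\<^sub>R axis (e i k) (1::real))
        = (\<Sum>k\<le>n i. if k = n i then c $ i *\<^sub>R axis (e i k) 1 else 0)"
      by (intro sum.cong) auto
    then show "c $ i *\<^sub>R axis (e i (n i)) 1 = (\<Sum>k\<le>n i. ?s i k *\<^sub>R axis (e i k) (1::real))"
      by simp
  qed
  have shifted: "(x + (\<Sum>i\<in>UNIV. c $ i *\<^sub>R axis (e i (n i)) 1)) $ e i k = x $ e i k + ?s i k"
    if "k \<le> n i" for i k
    unfolding jump vector_add_component by (simp only: component_sum_axis[OF e that])
  have "lyapunov n e \<alpha> b (x + (\<Sum>i\<in>UNIV. c $ i *\<^sub>R axis (e i (n i)) 1))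
      = 1 + (\<Sum>i\<in>UNIV. \<Sum>k\<le>n i. b (k + 1) / \<alpha> i ^ k * \<bar>x $ e i k + ?s i k\<bar>)"
    unfolding lyapunov_def
    by (intro arg_cong[where f = "(+) 1"] sum.cong refl) (simp only: shifted atMost_iff)
  also have "\<dots> \<le> 1 + (\<Sum>i\<in>UNIV. \<Sum>k\<le>n i.
      b (k + 1) / \<alpha> i ^ k * \<bar>x $ e i k\<bar> + (if k = n i then b (k + 1) / \<alpha> i ^ k * \<bar>c $ i\<bar> else 0))"
  proof (intro add_left_mono sum_mono)
    fix i k assume "k \<in> {..n i}"
    then have w: "b (k + 1) / \<alpha> i ^ k \<ge> 0" using a[of i] b[of "k + 1" i] by simp
    show "b (k + 1) / \<alpha> i ^ k * \<bar>x $ e i k + ?s i k\<bar> \<le> b (k + 1) / \<alpha> i ^ k * \<bar>x $ e i k\<bar>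
        + (if k = n i then b (k + 1) / \<alpha> i ^ k * \<bar>c $ i\<bar> else 0)"
      using mult_left_mono[OF abs_triangle_ineq[of "x $ e i k" "c $ i"] w]
      by (auto simp: distrib_left)
  qed
  also have "\<dots> = lyapunov n e \<alpha> b x + (\<Sum>i\<in>UNIV. b (n i + 1) / \<alpha> i ^ n i * \<bar>c $ i\<bar>)"
    by (simp add: lyapunov_def sum.distrib)
  finally show ?thesis by simp
qed

text \<open>
  Replacing each \<open>b (n i + 1)\<close> and \<open>\<alpha> i\<close> by the uniform bounds \<open>B\<close> and \<open>A\<close> gives the moment
  of \<open>G\<close> in which the smallness condition is stated.
\<close>

lemma integral_jump_lyapunov_le:
  fixes e :: "'l::finite \<Rightarrow> nat \<Rightarrow> 'k::finite"
  assumes e: "coordinate_labelling n e" and A: "A > 0" "\<And>i. A \<le> \<alpha> i"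
    and b: "\<And>i k. k \<le> n i + 1 \<Longrightarrow> b k \<ge> 0" and B: "\<And>i. b (n i + 1) \<le> B"
    and M: "integrable G (\<lambda>c. \<Sum>i\<in>UNIV. 1 / A ^ n i * \<bar>c $ i\<bar>)"
  shows "(\<integral>c. (lyapunov n e \<alpha> b (x + (\<Sum>i\<in>UNIV. c $ i *\<^sub>R axis (e i (n i)) 1))
      - lyapunov n e \<alpha> b x) \<partial>G) \<le> B * (\<integral>c. (\<Sum>i\<in>UNIV. 1 / A ^ n i * \<bar>c $ i\<bar>) \<partial>G)"
proof -
  have a: "\<alpha> i > 0" for i using A(1) A(2)[of i] by linarith
  have B0: "B \<ge> 0" using b[of "n undefined + 1" undefined] B[of undefined] by linarith
  have weight: "b (n i + 1) / \<alpha> i ^ n i \<le> B * (1 / A ^ n i)" for i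
    using frac_le[OF B0 B, of "A ^ n i" "\<alpha> i ^ n i" i] A power_mono[of A "\<alpha> i" "n i"]
    by simp
  have bound: "lyapunov n e \<alpha> b (x + (\<Sum>i\<in>UNIV. c $ i *\<^sub>R axis (e i (n i)) 1)) - lyapunov n e \<alpha> b x
      \<le> B * (\<Sum>i\<in>UNIV. 1 / A ^ n i * \<bar>c $ i\<bar>)" for c
  proof -
    have "(\<Sum>i\<in>UNIV. b (n i + 1) / \<alpha> i ^ n i * \<bar>c $ i\<bar>) \<le> (\<Sum>i\<in>UNIV. B * (1 / A ^ n i) * \<bar>c $ i\<bar>)"
      by (intro sum_mono mult_right_mono weight) simp
    moreover have "lyapunov n e \<alpha> b (x + (\<Sum>i\<in>UNIV. c $ i *\<^sub>R axis (e i (n i)) 1)) - lyapunov n e \<alpha> b x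
        \<le> (\<Sum>i\<in>UNIV. b (n i + 1) / \<alpha> i ^ n i * \<bar>c $ i\<bar>)"
      by (intro jump_lyapunov_le e a b)
    ultimately show ?thesis by (simp add: sum_distrib_left mult.assoc)
  qed
  have "(\<integral>c. (lyapunov n e \<alpha> b (x + (\<Sum>i\<in>UNIV. c $ i *\<^sub>R axis (e i (n i)) 1))
      - lyapunov n e \<alpha> b x) \<partial>G) \<le> (\<integral>c. B * (\<Sum>i\<in>UNIV. 1 / A ^ n i * \<bar>c $ i\<bar>) \<partial>G)"
    using A(1) B0 by (intro integral_mono' integrable_mult_right M bound mult_nonneg_nonneg sum_nonneg) auto
  then show ?thesis using M by simp
qed

section \<open>From a coordinatewise bound to the drift condition\<close>

lemma ex_pos_lower_bound:
  fixes g :: "'a \<Rightarrow> real"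
  assumes "finite P" "\<And>p. p \<in> P \<Longrightarrow> g p > 0"
  shows "\<exists>m>0. \<forall>p\<in>P. m \<le> g p"
  using assms
proof (intro exI conjI ballI)
  show "0 < Min (insert 1 (g ` P))" using assms by (subst Min_gr_iff) auto
qed (use assms in auto)

text \<open>
  With \<open>\<delta>\<close> a positive lower bound of the ratios of loss rate \<open>d i k\<close> to weight in \<open>V\<close>, and
  \<open>\<beta> = C + \<delta>\<close> (the \<open>\<delta>\<close> pays for the summand \<open>1\<close> of \<open>V\<close>), the hypothesis implies \<open>LV x \<le> \<beta> - \<delta> * V x\<close>. Giving up half of \<open>\<delta>\<close> leaves a spare \<open>\<delta> / 2 * V x\<close>, which exceeds \<open>\<beta>\<close>
  outside a large ball.
\<close>

lemma foster_lyapunov_of_coordinate_bound: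
  fixes e :: "'l::finite \<Rightarrow> nat \<Rightarrow> 'k::finite" and LV :: "real ^ 'k \<Rightarrow> real"
  assumes e: "coordinate_labelling n e" and a: "\<And>i. \<alpha> i > 0"
    and b: "\<And>i k. k \<le> n i \<Longrightarrow> b (k + 1) > 0"
    and d: "\<And>i k. k \<le> n i \<Longrightarrow> d i k > 0" and C: "C \<ge> 0"
    and LV: "\<And>x. LV x \<le> C - (\<Sum>i\<in>UNIV. \<Sum>k\<le>n i. d i k * \<bar>x $ e i k\<bar>)"
  shows "\<exists>lam \<beta> R. lam > 0 \<and> \<beta> > 0 \<and> R > 0 \<and>
    (\<forall>x. LV x \<le> - lam * lyapunov n e \<alpha> b x + \<beta> * indicator (cball 0 R) x)"
proof -
  let ?P = "SIGMA i:UNIV. {..n i}"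
  let ?w = "\<lambda>i k. b (k + 1) / \<alpha> i ^ k"
  let ?V = "lyapunov n e \<alpha> b"
  have w: "?w i k > 0" if "k \<le> n i" for i k using a b[OF that] by simp
  have "\<exists>m>0. \<forall>p\<in>?P. m \<le> ?w (fst p) (snd p)"
    using w by (intro ex_pos_lower_bound finite_SigmaI) auto
  then obtain m where m: "m > 0" "\<And>i k. k \<le> n i \<Longrightarrow> m \<le> ?w i k" by fastforce
  have "\<exists>\<delta>>0. \<forall>p\<in>?P. \<delta> \<le> d (fst p) (snd p) / ?w (fst p) (snd p)"
    using a b d by (intro ex_pos_lower_bound finite_SigmaI) auto
  then obtain \<delta> where \<delta>: "\<delta> > 0" "\<And>i k. k \<le> n i \<Longrightarrow> \<delta> \<le> d i k / ?w i k" by fastforce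
  have rate: "\<delta> * ?w i k \<le> d i k" if "k \<le> n i" for i k
    using \<delta>(2)[OF that] w[OF that] by (subst (asm) pos_le_divide_eq) auto
  define \<beta> where "\<beta> = C + \<delta>"
  define R where "R = 2 * \<beta> / (\<delta> * m)"
  have \<beta>: "\<beta> > 0" using C \<delta> by (simp add: \<beta>_def)
  have R: "R > 0" using \<beta> \<delta> m by (simp add: R_def)
  have LV_le: "LV x \<le> \<beta> - \<delta> * ?V x" for x
  proof -
    have "\<delta> * (\<Sum>i\<in>UNIV. \<Sum>k\<le>n i. ?w i k * \<bar>x $ e i k\<bar>)
        = (\<Sum>i\<in>UNIV. \<Sum>k\<le>n i. \<delta> * ?w i k * \<bar>x $ e i k\<bar>)"
      by (simp add: sum_distrib_left mult.assoc)
    also have "\<dots> \<le> (\<Sum>i\<in>UNIV. \<Sum>k\<le>n i. d i k * \<bar>x $ e i k\<bar>)"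
      using rate by (intro sum_mono mult_right_mono) auto
    finally show ?thesis using LV[of x] by (simp add: lyapunov_def \<beta>_def distrib_left)
  qed
  have V_ge: "m * norm x \<le> ?V x" for x
  proof -
    have "m * norm x \<le> m * (\<Sum>i\<in>UNIV. \<Sum>k\<le>n i. \<bar>x $ e i k\<bar>)"
      using norm_le_l1_cart[of x] m sum_coordinates[OF e, of "\<lambda>s. \<bar>x $ s\<bar>"] by simp
    also have "\<dots> \<le> (\<Sum>i\<in>UNIV. \<Sum>k\<le>n i. ?w i k * \<bar>x $ e i k\<bar>)"
      unfolding sum_distrib_left using m by (intro sum_mono mult_right_mono) auto
    finally show ?thesis by (simp add: lyapunov_def)
  qed
  have "LV x \<le> - (\<delta> / 2) * ?V x + \<beta> * indicator (cball 0 R) x" for x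
  proof (cases "x \<in> cball 0 R")
    case True
    have "0 \<le> ?V x" using V_ge[of x] m by (intro order_trans[OF _ V_ge]) simp
    then have "0 \<le> \<delta> / 2 * ?V x" using \<delta> by simp
    then show ?thesis using LV_le[of x] True by simp
  next
    case False
    then have "m * R \<le> m * norm x" using m by simp
    then have "\<delta> / 2 * (m * R) \<le> \<delta> / 2 * ?V x"
      using V_ge[of x] \<delta> by (intro mult_left_mono) auto
    moreover have "\<delta> / 2 * (m * R) = \<beta>" using \<delta> m by (simp add: R_def)
    ultimately show ?thesis using LV_le[of x] False by simp
  qed
  then show ?thesis using \<delta> \<beta> R by (intro exI[of _ "\<delta> / 2"] exI[of _ \<beta>] exI[of _ R]) simp
qed

section \<open>The drift condition\<close>

theorem proposition3:
  fixes n :: "'l::finite \<Rightarrow> nat"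
    and e :: "'l \<Rightarrow> nat \<Rightarrow> 'k::finite"
    and \<alpha> :: "'l \<Rightarrow> real"
    and G :: "(real ^ 'l) measure"
    and f :: "real \<Rightarrow> real"
    and Lip :: real
    and b :: "nat \<Rightarrow> real"
  assumes "coordinate_labelling n e"
    and "\<And>i. \<alpha> i > 0"
    and "prob_space G" and "sets G = sets borel"
    and "f \<in> borel_measurable borel" and "\<And>u. f u \<ge> 0"
    and "bounded (range f) \<or> Lip-lipschitz_on UNIV f"
    and "integrable G (\<lambda>c. \<Sum>i\<in>UNIV. \<bar>c $ i\<bar>)"
    and "\<And>k. k \<le> Max (range n) + 1 \<Longrightarrow> b k \<ge> 0"
    and "strict_mono_on {0..Max (range n) + 1} b"
    and "\<not> bounded (range f) \<Longrightarrow>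
           Lip * (\<integral>c. (\<Sum>i\<in>UNIV. 1 / Min (range \<alpha>) ^ n i * \<bar>c $ i\<bar>) \<partial>G) < Min (range \<alpha>)"
    and "\<not> bounded (range f) \<Longrightarrow>
           b (Max (range n) + 1) / b 1 * Lip *
             (\<integral>c. (\<Sum>i\<in>UNIV. 1 / Min (range \<alpha>) ^ n i * \<bar>c $ i\<bar>) \<partial>G) < Min (range \<alpha>)"
  shows "\<exists>lam \<beta> R. lam > 0 \<and> \<beta> > 0 \<and> R > 0 \<and>
           (\<forall>x. generator n e \<alpha> f G (lyapunov n e \<alpha> b) (lyapunov_grad n e \<alpha> b) x
                 \<le> - lam * lyapunov n e \<alpha> b x + \<beta> * indicator (cball 0 R) x)"
proof -
  let ?N = "Max (range n)" and ?A = "Min (range \<alpha>)"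
  let ?M = "\<integral>c. (\<Sum>i\<in>UNIV. 1 / ?A ^ n i * \<bar>c $ i\<bar>) \<partial>G"
  let ?V = "lyapunov n e \<alpha> b"
  define J where "J = b (?N + 1) * ?M"
  note e = assms(1) and a = assms(2)
  have A: "?A > 0" "?A \<le> \<alpha> i" for i using a by auto
  have n_le: "n i \<le> ?N" for i by simp
  have b_nonneg: "b k \<ge> 0" if "k \<le> n i + 1" for i k
    using assms(9)[of k] that n_le[of i] by linarith
  have b_less: "b k < b (k + 1)" if "k \<le> n i" for i k
    using strict_mono_onD[OF assms(10), of k "k + 1"] that n_le[of i] by simp
  have b_pos: "b (k + 1) > 0" if "k \<le> n i" for i k
    using b_less[OF that] b_nonneg[of k i] that by simp
  have b_top: "b (n i + 1) \<le> b (?N + 1)" for i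
    using strict_mono_on_leD[OF assms(10), of "n i + 1" "?N + 1"] n_le[of i] by simp
  have b1: "b 1 > 0" using b_pos[of 0] by simp

  have moment: "integrable G (\<lambda>c. \<Sum>i\<in>UNIV. 1 / ?A ^ n i * \<bar>c $ i\<bar>)"
  proof (intro Bochner_Integration.integrable_sum integrable_mult_right)
    fix i
    have "(\<lambda>c :: real ^ 'l. \<bar>c $ i\<bar>) \<in> borel_measurable G"
      using assms(4) by (simp cong: measurable_cong_sets)
    moreover have "norm \<bar>c $ i\<bar> \<le> norm (\<Sum>i\<in>UNIV. \<bar>c $ i\<bar>)" for c :: "real ^ 'l"
      using member_le_sum[of i UNIV "\<lambda>i. \<bar>c $ i\<bar>"] by simp
    ultimately show "integrable G (\<lambda>c. \<bar>c $ i\<bar>)"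
      by (intro Bochner_Integration.integrable_bound[OF assms(8)]) auto
  qed
  have "?M \<ge> 0"
    using A(1) by (intro Bochner_Integration.integral_nonneg sum_nonneg mult_nonneg_nonneg
        divide_nonneg_nonneg zero_le_power less_imp_le abs_ge_zero zero_le_one)
  then have J: "J \<ge> 0" using assms(9)[of "?N + 1"] by (simp add: J_def)

  obtain c\<^sub>0 \<rho> where f_le: "\<And>u. f u \<le> c\<^sub>0 + \<rho> * \<bar>u\<bar>" and \<rho>: "\<rho> \<ge> 0" "\<rho> * J < ?A * b 1"
  proof (cases "bounded (range f)")
    case True
    then obtain B where "\<And>u. \<bar>f u\<bar> \<le> B" by (auto simp: bounded_iff)
    then have "f u \<le> B + 0 * \<bar>u\<bar>" for u using abs_le_D1 by auto
    then show ?thesis using that[of B 0] A(1) b1 by simp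
  next
    case False
    then have lip: "Lip-lipschitz_on UNIV f" using assms(7) by simp
    have "f u \<le> f 0 + Lip * \<bar>u\<bar>" for u
      using lipschitz_onD[OF lip, of u 0] by (simp add: dist_real_def)
    moreover have "Lip * J < ?A * b 1"
    proof -
      have "Lip * J = b (?N + 1) / b 1 * Lip * ?M * b 1" using b1 by (simp add: J_def)
      also have "\<dots> < ?A * b 1" using assms(12)[OF False] b1 by (rule mult_strict_right_mono)
      finally show ?thesis .
    qed
    ultimately show ?thesis using that lipschitz_on_nonneg[OF lip] by blast
  qed
  have c0: "c\<^sub>0 \<ge> 0" using f_le[of 0] assms(6)[of 0] by simp

  define l where "l i k = \<alpha> i / \<alpha> i ^ k * (b (k + 1) - (if k = 0 then 0 else b k))" for i k
  \<comment> \<open>Through the linear bound on \<open>f\<close>, the mean jump costs \<open>\<rho> * J\<close> per unit of \<open>\<bar>x $ e i 0\<bar>\<close>.\<close>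
  define d where "d i k = l i k - (if k = 0 then \<rho> * J else 0)" for i k
  have d_pos: "d i k > 0" if "k \<le> n i" for i k
  proof (cases "k = 0")
    case True
    have "?A * b 1 \<le> \<alpha> i * b 1" using A(2) b1 by (intro mult_right_mono) auto
    then show ?thesis using \<rho> True by (simp add: d_def l_def)
  next
    case False
    then show ?thesis using a[of i] b_less[OF that] by (simp add: d_def l_def)
  qed

  have bound: "generator n e \<alpha> f G ?V (lyapunov_grad n e \<alpha> b) x
      \<le> c\<^sub>0 * J - (\<Sum>i\<in>UNIV. \<Sum>k\<le>n i. d i k * \<bar>x $ e i k\<bar>)" for x
  proof -
    let ?u = "\<Sum>i\<in>UNIV. x $ e i 0"
    have drift: "drift_field n e \<alpha> x \<bullet> lyapunov_grad n e \<alpha> b x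
        \<le> - (\<Sum>i\<in>UNIV. \<Sum>k\<le>n i. l i k * \<bar>x $ e i k\<bar>)"
      unfolding l_def by (intro drift_lyapunov_le e a b_nonneg)
    have "f ?u * (\<integral>c. (?V (x + (\<Sum>i\<in>UNIV. c $ i *\<^sub>R axis (e i (n i)) 1)) - ?V x) \<partial>G) \<le> f ?u * J"
      unfolding J_def
      by (intro mult_left_mono assms(6) integral_jump_lyapunov_le e A b_nonneg b_top moment)
    also have "\<dots> \<le> (c\<^sub>0 + \<rho> * (\<Sum>i\<in>UNIV. \<bar>x $ e i 0\<bar>)) * J"
      using \<rho> J by (intro mult_right_mono order_trans[OF f_le] add_left_mono mult_left_mono sum_abs)
    also have "\<dots> = c\<^sub>0 * J + (\<Sum>i\<in>UNIV. \<Sum>k\<le>n i. (if k = 0 then \<rho> * J * \<bar>x $ e i k\<bar> else 0))"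
      by (simp add: distrib_left distrib_right sum_distrib_left sum_distrib_right mult_ac)
    finally have "generator n e \<alpha> f G ?V (lyapunov_grad n e \<alpha> b) x
        \<le> - (\<Sum>i\<in>UNIV. \<Sum>k\<le>n i. l i k * \<bar>x $ e i k\<bar>)
          + (c\<^sub>0 * J + (\<Sum>i\<in>UNIV. \<Sum>k\<le>n i. (if k = 0 then \<rho> * J * \<bar>x $ e i k\<bar> else 0)))"
      unfolding generator_def using drift by (rule add_mono[rotated])
    also have "\<dots> = c\<^sub>0 * J - (\<Sum>i\<in>UNIV. \<Sum>k\<le>n i. d i k * \<bar>x $ e i k\<bar>)"
    proof -
      have "(\<Sum>i\<in>UNIV. \<Sum>k\<le>n i. d i k * \<bar>x $ e i k\<bar>)
          = (\<Sum>i\<in>UNIV. \<Sum>k\<le>n i. l i k * \<bar>x $ e i k\<bar> - (if k = 0 then \<rho> * J * \<bar>x $ e i k\<bar> else 0))"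
        by (intro sum.cong refl) (simp add: d_def left_diff_distrib)
      then show ?thesis by (simp only: sum_subtractf)
    qed
    finally show ?thesis .
  qed
  have "c\<^sub>0 * J \<ge> 0" using c0 J by simp
  then show ?thesis
    using e a b_pos d_pos bound
    by (intro foster_lyapunov_of_coordinate_bound[where C = "c\<^sub>0 * J" and d = d])
qed

end
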